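(* Let $1\le r<n$ and let $A\in\mathbb{R}^{n\times n}$ be symmetric with eigenvalues $\lambda_1\ge\dots\ge\lambda_n$ satisfying $\lambda_r>\lambda_{r+1}$, and eigen-decomposition $A=V_1\Lambda_1V_1^T+V_2\Lambda_2V_2^T$, where $\Lambda_1=\mathrm{diag}(\lambda_1,\dots,\lambda_r)$, $\Lambda_2=\mathrm{diag}(\lambda_{r+1},\dots,\lambda_n)$, and $V_1\in\mathbb{R}^{n\times r}$, $V_2\in\mathbb{R}^{n\times(n-r)}$ have orthonormal columns that are the associated eigenvectors. Let $E\in\mathbb{R}^{n\times n}$ be symmetric, $\widehat A=A+E$, and $$\mathsf{gap}=\min\{\mathsf{sep}_2(\Lambda_1,\Lambda_2),\ \mathsf{sep}_{(2,\infty),V_2}(\Lambda_1,V_2\Lambda_2V_2^T)\}.$$ If $\|E\|_2\le \frac{\mathsf{gap}}{5}$, then $$\min\{\|\widehat V_1U-V_1\|_{2,\infty}:U\in\mathbf{O}^r\}\le 8\|V_1\|_{2,\infty}\left(\frac{\|E_{2,1}\|_2}{\mathsf{sep}_2(\Lambda_1,\Lambda_2)}\right)^2+2\,\frac{\|V_2E_{2,1}\|_{2,\infty}}{\mathsf{gap}}+4\,\frac{\|V_2E_{2,2}V_2^T\|_{2,\infty}\,\|E_{2,1}\|_2}{\mathsf{gap}\cdot\mathsf{sep}_2(\Lambda_1,\Lambda_2)},$$ where $\widehat V_1\in\mathbb{R}^{n\times r}$ is any matrix with orthonormal columns whose range is the dominant $r$-dimensional invariant subspace of $\widehat A$.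
   Context: $\mathbf{O}^r$ is the set of $r\times r$ orthogonal matrices. The dominant $r$-dimensional invariant subspace of a symmetric matrix is the one associated with its $r$ algebraically largest eigenvalues. $\|\cdot\|_2$ is the spectral norm, and $\|B\|_{2,\infty}=\max_i\|B_{i,:}\|_2$ is the maximum Euclidean norm of the rows of $B$. For $B\in\mathbb{R}^{n\times n}$ and $i,j\in\{1,2\}$, $B_{i,j}:=V_i^TBV_j$. For $B\in\mathbb{R}^{\ell\times\ell}$, $C\in\mathbb{R}^{m\times m}$ and a norm $\|\cdot\|_*$ on $\mathbb{R}^{m\times\ell}$, $\mathsf{sep}_*(B,C)=\inf\{\|ZB-CZ\|_*: Z\in\mathbb{R}^{m\times\ell},\ \|Z\|_*=1\}$. For a matrix $W$ with $m$ rows and orthonormal columns, $\mathsf{sep}_{*,W}(B,C)=\inf\{\|ZB-CZ\|_*: Z\in\mathbb{R}^{m\times\ell},\ \text{every column of } Z \text{ lies in } \mathrm{ran}\,W,\ \|Z\|_*=1\}$. The subscripts $2$ and $(2,\infty)$ refer to the norms $\|\cdot\|_2$ and $\|\cdot\|_{2,\infty}$. *)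

theory Defs
  imports "HOL-Analysis.Analysis"
begin

text \<open>A matrix with \<open>m\<close> rows and \<open>l\<close> columns has type \<open>real^'l^'m\<close>.\<close>

definition spectral_norm :: "real^'l^'m \<Rightarrow> real" where
  "spectral_norm B = onorm ((*v) B)"

definition two_inf_norm :: "real^'l^'m \<Rightarrow> real" where
  "two_inf_norm B = (MAX i. norm (row i B))"

definition diag_matrix :: "('k \<Rightarrow> real) \<Rightarrow> real^'k^'k" where
  "diag_matrix d = (\<chi> i j. if i = j then d i else 0)"

definition block :: "real^'k^'n \<Rightarrow> real^'l^'n \<Rightarrow> real^'n^'n \<Rightarrow> real^'l^'k" where
  "block V W B = transpose V ** B ** W"

definition sep :: "(real^'l^'m \<Rightarrow> real) \<Rightarrow> real^'l^'l \<Rightarrow> real^'m^'m \<Rightarrow> real" where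
  "sep N B C = Inf {N (Z ** B - C ** Z) | Z. N Z = 1}"

definition sep_on ::
    "(real^'l^'m \<Rightarrow> real) \<Rightarrow> real^'k^'m \<Rightarrow> real^'l^'l \<Rightarrow> real^'m^'m \<Rightarrow> real" where
  "sep_on N W B C =
     Inf {N (Z ** B - C ** Z) | Z. (\<forall>j. column j Z \<in> range ((*v) W)) \<and> N Z = 1}"

text \<open>
  The vectors \<open>v 1, \<dots>, v n\<close> form an orthonormal eigenbasis ordered by decreasing eigenvalue.
  For a symmetric \<open>M\<close> such a basis exists; the subspace \<open>S\<close> is unique if the \<open>r\<close>-th and
  \<open>(r+1)\<close>-st largest eigenvalues differ, otherwise every admissible choice counts as dominant.
\<close>

definition dominant_invariant_subspace :: "nat \<Rightarrow> real^'n^'n \<Rightarrow> (real^'n) set \<Rightarrow> bool" where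
  "dominant_invariant_subspace r M S \<longleftrightarrow>
     (\<exists>(v :: nat \<Rightarrow> real^'n) (\<mu> :: nat \<Rightarrow> real).
        (\<forall>i\<in>{1..CARD('n)}. \<forall>j\<in>{1..CARD('n)}. v i \<bullet> v j = (if i = j then 1 else 0)) \<and>
        (\<forall>i\<in>{1..CARD('n)}. M *v v i = \<mu> i *\<^sub>R v i) \<and>
        (\<forall>i\<in>{1..CARD('n)}. \<forall>j\<in>{1..CARD('n)}. i \<le> j \<longrightarrow> \<mu> j \<le> \<mu> i) \<and>
        S = span (v ` {1..r}))"

end

theory Submission
  imports Defs
begin

text \<open>
  Write \<open>S = V\<^sub>2\<^sup>T Vhat\<^sub>1\<close>. By Weyl's inequality the \<open>r\<close>-th eigenvalue of \<open>A + E\<close> stays above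
  \<open>\<lambda>\<^sub>r - \<parallel>E\<parallel>\<close>, so a Davis--Kahan argument gives \<open>\<parallel>S\<parallel> \<le> 1/4\<close>. Rotating \<open>Vhat\<^sub>1\<close> by the orthogonal polar
  factor \<open>U\<close> of \<open>V\<^sub>1\<^sup>T Vhat\<^sub>1\<close> one gets \<open>Vhat\<^sub>1 U = (V\<^sub>1 + V\<^sub>2 X) P\<close> with \<open>P\<close> symmetric positive definite,
  \<open>\<parallel>P - I\<parallel> \<le> \<parallel>X\<parallel>\<^sup>2\<close> and \<open>\<parallel>X\<parallel> \<le> 1/3\<close>. Invariance of the subspace is the Riccati equation
  \<open>X \<Lambda>\<^sub>1 - \<Lambda>\<^sub>2 X = E\<^sub>2\<^sub>1 + E\<^sub>2\<^sub>2 X - X E\<^sub>1\<^sub>1 - X E\<^sub>1\<^sub>2 X\<close>, from which the two separations bound \<open>X\<close> in the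
  spectral norm and \<open>V\<^sub>2 X\<close> in the \<open>(2,\<infinity>)\<close>-norm. The estimate then follows from
  \<open>Vhat\<^sub>1 U - V\<^sub>1 = V\<^sub>1 (P - I) + V\<^sub>2 X P\<close>, and the minimising rotation can only do better.
\<close>

section \<open>Matrix norms and separation\<close>

text \<open>As a simp rule this would turn \<open>transpose A *v x\<close> into a vector-matrix
  product; adjoints are kept as explicit transposes throughout.\<close>

declare transpose_matrix_vector [simp del]

lemma matrix_add_rdistrib: "(A + B) ** C = A ** C + B ** (C :: real^'l^'m)"
  by (simp add: vec_eq_iff matrix_matrix_mult_def algebra_simps sum.distrib)

lemma matrix_diff_ldistrib: "A ** (B - C) = A ** B - A ** (C :: real^'l^'m)"
  by (simp add: vec_eq_iff matrix_matrix_mult_def algebra_simps sum_subtractf)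

lemma matrix_diff_rdistrib: "(A - B) ** C = A ** C - B ** (C :: real^'l^'m)"
  by (simp add: vec_eq_iff matrix_matrix_mult_def algebra_simps sum_subtractf)

lemma scaleR_matrix_mult: "(c *\<^sub>R A) ** B = c *\<^sub>R (A ** (B :: real^'l^'m))"
  by (simp add: vec_eq_iff matrix_matrix_mult_def sum_distrib_left mult_ac)

lemma matrix_mult_scaleR: "A ** (c *\<^sub>R B) = c *\<^sub>R (A ** (B :: real^'l^'m))"
  by (simp add: vec_eq_iff matrix_matrix_mult_def sum_distrib_left mult_ac)

lemma inner_transpose_left: "(transpose A *v x) \<bullet> y = x \<bullet> (A *v (y :: real^'l))"
  by (simp add: transpose_matrix_vector dot_lmul_matrix)

lemma inner_transpose_right: "y \<bullet> (transpose A *v x) = (A *v (y :: real^'l)) \<bullet> x"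
  by (metis inner_commute inner_transpose_left)

lemma symmetric_inner:
  fixes P :: "real^'r^'r"
  assumes "transpose P = P"
  shows "(P *v x) \<bullet> y = x \<bullet> (P *v y)"
  using assms inner_transpose_left by metis

lemma symmetric_matrixI:
  fixes P :: "real^'r^'r"
  assumes "\<And>x y. (P *v x) \<bullet> y = x \<bullet> (P *v y)"
  shows "transpose P = P"
proof -
  have "transpose P *v x = P *v x" for x
    by (simp add: vector_eq_rdot[symmetric] inner_transpose_left assms)
  then show ?thesis by (simp add: matrix_eq)
qed

section \<open>The spectral norm\<close>

lemma norm_matrix_vector_le: "norm (B *v x) \<le> spectral_norm B * norm x"
  unfolding spectral_norm_def by (rule onorm) simp

lemma spectral_norm_leI: "(\<And>x. norm (B *v x) \<le> b * norm x) \<Longrightarrow> spectral_norm B \<le> b"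
  unfolding spectral_norm_def by (rule onorm_le)

lemma spectral_norm_nonneg: "0 \<le> spectral_norm B"
  unfolding spectral_norm_def by (rule onorm_pos_le) simp

lemma spectral_norm_eq_0: "spectral_norm B = 0 \<longleftrightarrow> B = 0"
  unfolding spectral_norm_def by (subst onorm_eq_0) (auto simp: matrix_eq)

lemma spectral_norm_triangle: "spectral_norm (B + C) \<le> spectral_norm B + spectral_norm C"
  unfolding spectral_norm_def using onorm_triangle[of "(*v) B" "(*v) C"]
  by (simp flip: matrix_vector_mult_add_rdistrib)

lemma spectral_norm_scaleR: "spectral_norm (c *\<^sub>R B) = \<bar>c\<bar> * spectral_norm B"
  unfolding spectral_norm_def using onorm_scaleR[of "(*v) B" c]
  by (simp add: scaleR_matrix_vector_assoc)

lemma spectral_norm_diff: "spectral_norm (B - C) \<le> spectral_norm B + spectral_norm C"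
  using spectral_norm_triangle[of B "(-1) *\<^sub>R C"]
  by (simp add: spectral_norm_scaleR[of "-1", simplified])

lemma spectral_norm_mult: "spectral_norm (B ** C) \<le> spectral_norm B * spectral_norm C"
proof (rule spectral_norm_leI)
  fix x
  have "norm (B *v (C *v x)) \<le> spectral_norm B * (spectral_norm C * norm x)"
    by (meson norm_matrix_vector_le mult_left_mono order_trans spectral_norm_nonneg)
  then show "norm ((B ** C) *v x) \<le> spectral_norm B * spectral_norm C * norm x"
    by (simp add: matrix_vector_mul_assoc mult.assoc)
qed

text \<open>With \<open>y = transpose B *v x\<close>, Cauchy-Schwarz applied to
  \<open>y \<bullet> y = x \<bullet> (B *v y)\<close> leaves a factor \<open>norm y\<close> to
  cancel. Applying this twice gives equality of the two norms.\<close>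

lemma spectral_norm_transpose_le: "spectral_norm (transpose B) \<le> spectral_norm B"
proof (rule spectral_norm_leI)
  fix x
  let ?y = "transpose B *v x"
  have "norm ?y * norm ?y = x \<bullet> (B *v ?y)"
    by (simp flip: inner_transpose_left add: dot_square_norm power2_eq_square)
  also have "\<dots> \<le> norm x * (spectral_norm B * norm ?y)"
    by (meson norm_matrix_vector_le mult_left_mono order_trans norm_cauchy_schwarz norm_ge_zero)
  finally have "norm ?y * norm ?y \<le> (spectral_norm B * norm x) * norm ?y"
    by (simp add: mult_ac)
  then show "norm ?y \<le> spectral_norm B * norm x"
    by (cases "norm ?y = 0") (auto simp: spectral_norm_nonneg)
qed

lemma spectral_norm_transpose: "spectral_norm (transpose B) = spectral_norm B"
  by (metis spectral_norm_transpose_le order_antisym transpose_transpose)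

lemma norm_orthonormal_columns:
  fixes V :: "real^'l^'m"
  assumes "transpose V ** V = mat 1"
  shows "norm (V *v x) = norm x"
proof -
  have "(V *v x) \<bullet> (V *v x) = x \<bullet> x"
    by (metis assms inner_transpose_left matrix_vector_mul_assoc matrix_vector_mul_lid)
  then show ?thesis by (simp add: norm_eq_sqrt_inner)
qed

lemma spectral_norm_orthonormal_columns:
  assumes "transpose V ** V = mat 1"
  shows "spectral_norm V \<le> 1"
  by (rule spectral_norm_leI) (simp add: norm_orthonormal_columns[OF assms])

lemma spectral_norm_orthogonal: "orthogonal_matrix U \<Longrightarrow> spectral_norm (U :: real^'r^'r) \<le> 1"
  by (simp add: orthogonal_matrix spectral_norm_orthonormal_columns)

lemma spectral_norm_mult_le:
  assumes "spectral_norm B \<le> b" "spectral_norm C \<le> c"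
  shows "spectral_norm (B ** C) \<le> b * c"
  by (meson assms mult_mono order_trans spectral_norm_mult spectral_norm_nonneg)

lemma spectral_norm_block_le:
  assumes "transpose V ** V = mat 1" "transpose W ** W = mat 1"
  shows "spectral_norm (block V W B) \<le> spectral_norm B"
proof -
  have "spectral_norm (transpose V ** B ** W) \<le> 1 * spectral_norm B * 1"
    by (intro spectral_norm_mult_le order_refl)
      (simp_all add: spectral_norm_transpose spectral_norm_orthonormal_columns assms)
  then show ?thesis by (simp add: block_def)
qed

section \<open>The (2,infinity)-norm\<close>

lemma norm_row_le_two_inf: "norm (row i B) \<le> two_inf_norm B"
  unfolding two_inf_norm_def by (intro Max_ge) auto

lemma two_inf_norm_leI: "(\<And>i. norm (row i B) \<le> b) \<Longrightarrow> two_inf_norm B \<le> b"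
  unfolding two_inf_norm_def by (subst Max_le_iff) auto

lemma two_inf_norm_nonneg: "0 \<le> two_inf_norm B"
  by (rule order_trans[OF norm_ge_zero norm_row_le_two_inf])

lemma row_add: "row i (B + C) = row i B + row i C"
  by (simp add: row_def vec_eq_iff)

lemma row_diff: "row i (B - C) = row i B - row i C" for B C :: "real^'l^'m"
  by (simp add: row_def vec_eq_iff)

lemma row_scaleR: "row i (c *\<^sub>R B) = c *\<^sub>R row i B" for B :: "real^'l^'m"
  by (simp add: row_def vec_eq_iff)

lemma row_matrix_mult: "row i (B ** C) = transpose C *v row i B" for B :: "real^'l^'m"
  by (simp add: row_def vec_eq_iff matrix_matrix_mult_def matrix_vector_mult_def transpose_def
      mult.commute)

lemma two_inf_norm_triangle: "two_inf_norm (B + C) \<le> two_inf_norm B + two_inf_norm C"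
  for B C :: "real^'l^'m"
  by (rule two_inf_norm_leI)
    (simp add: row_add norm_row_le_two_inf norm_triangle_le add_mono)

lemma two_inf_norm_diff: "two_inf_norm (B - C) \<le> two_inf_norm B + two_inf_norm C"
  for B C :: "real^'l^'m"
  by (rule two_inf_norm_leI)
    (simp add: row_diff norm_row_le_two_inf norm_triangle_le_diff add_mono)

lemma two_inf_norm_scaleR: "two_inf_norm (c *\<^sub>R B) = \<bar>c\<bar> * two_inf_norm B" for B :: "real^'l^'m"
proof (rule antisym)
  show "two_inf_norm (c *\<^sub>R B) \<le> \<bar>c\<bar> * two_inf_norm B"
    by (rule two_inf_norm_leI) (simp add: row_scaleR mult_left_mono norm_row_le_two_inf)
  have "two_inf_norm B \<in> range (\<lambda>i. norm (row i B))"
    unfolding two_inf_norm_def by (rule Max_in) auto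
  then obtain i where "two_inf_norm B = norm (row i B)" by auto
  then show "\<bar>c\<bar> * two_inf_norm B \<le> two_inf_norm (c *\<^sub>R B)"
    by (metis norm_row_le_two_inf norm_scaleR row_scaleR)
qed

text \<open>Each row of the product is \<open>transpose C\<close> applied to a row of
  \<open>B\<close>, so the right factor enters through its spectral norm. All row-wise estimates of
  the Riccati terms rest on this mixed bound.\<close>

lemma two_inf_norm_mult_le:
  fixes B :: "real^'l^'m"
  assumes "two_inf_norm B \<le> b" "spectral_norm C \<le> c"
  shows "two_inf_norm (B ** C) \<le> b * c"
proof (rule two_inf_norm_leI)
  fix i
  have "norm (row i (B ** C)) \<le> spectral_norm C * norm (row i B)"
    by (metis norm_matrix_vector_le row_matrix_mult spectral_norm_transpose)
  also have "\<dots> \<le> c * b"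
    by (meson assms mult_mono norm_ge_zero norm_row_le_two_inf order_trans spectral_norm_nonneg)
  finally show "norm (row i (B ** C)) \<le> b * c" by (simp add: mult.commute)
qed

text \<open>Gives continuity of the (2,infinity)-norm, hence existence of the minimising
  rotation.\<close>

lemma continuous_on_Max_finite:
  fixes f :: "'i \<Rightarrow> 'a::topological_space \<Rightarrow> real"
  assumes "finite I" "I \<noteq> {}" "\<And>i. i \<in> I \<Longrightarrow> continuous_on S (f i)"
  shows "continuous_on S (\<lambda>x. MAX i\<in>I. f i x)"
  using assms
proof (induction I rule: finite_ne_induct)
  case (insert i I)
  have "continuous_on S (\<lambda>x. max (f i x) (MAX i\<in>I. f i x))"
    using insert by (intro continuous_on_max) auto
  with insert.hyps show ?case by simp
qed simp

section \<open>Separation as a lower bound for the Sylvester operator\<close>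

lemma sep_on_le:
  fixes N :: "real^'l^'m \<Rightarrow> real"
  assumes hom: "\<And>c Z. N (c *\<^sub>R Z) = \<bar>c\<bar> * N Z" and nonneg: "\<And>Z. 0 \<le> N Z"
    and Z: "\<And>j. column j Z \<in> range ((*v) W)"
  shows "sep_on N W B C * N Z \<le> N (Z ** B - C ** Z)"
proof (cases "N Z = 0")
  case False
  then have pos: "N Z > 0" using nonneg[of Z] by linarith
  \<comment> \<open>The normalised matrix competes in the infimum, which is bounded below by 0;
    homogeneity then removes the scaling.\<close>
  let ?Y = "inverse (N Z) *\<^sub>R Z"
  have "column j ?Y \<in> range ((*v) W)" for j
  proof -
    obtain y where "column j Z = W *v y" using Z by auto
    then have "column j ?Y = W *v (inverse (N Z) *\<^sub>R y)"
      by (simp add: column_def vec_eq_iff matrix_vector_mult_scaleR)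
    then show ?thesis by simp
  qed
  moreover have "N ?Y = 1" using pos by (simp add: hom)
  ultimately have "sep_on N W B C \<le> N (?Y ** B - C ** ?Y)"
    unfolding sep_on_def by (intro cInf_lower bdd_belowI[of _ 0]) (auto intro: nonneg)
  also have "?Y ** B - C ** ?Y = inverse (N Z) *\<^sub>R (Z ** B - C ** Z)"
    by (simp add: scaleR_matrix_mult matrix_mult_scaleR scaleR_diff_right)
  finally have "sep_on N W B C \<le> inverse (N Z) * N (Z ** B - C ** Z)"
    using pos by (simp only: hom) simp
  then show ?thesis using pos by (simp add: field_simps)
qed (simp add: nonneg)

text \<open>Range of the identity is everything, so results on the restricted separation transfer to
  \<open>sep\<close>.\<close>

lemma sep_eq_sep_on: "sep N B C = sep_on N (mat 1) B C"
proof -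
  have "z \<in> range ((*v) (mat 1))" for z :: "real^'m"
    by (rule range_eqI[of _ _ z]) simp
  then show ?thesis unfolding sep_def sep_on_def by simp
qed

lemma sep_le:
  fixes N :: "real^'l^'m \<Rightarrow> real"
  assumes "\<And>c Z. N (c *\<^sub>R Z) = \<bar>c\<bar> * N Z" and "\<And>Z. 0 \<le> N Z"
  shows "sep N B C * N Z \<le> N (Z ** B - C ** Z)"
  unfolding sep_eq_sep_on by (rule sep_on_le) (auto simp: assms)

lemma matrix_mult_column: "column j (A ** B) = A *v column j (B :: real^'l^'m)"
  by (simp add: column_def vec_eq_iff matrix_matrix_mult_def matrix_vector_mult_def)

section \<open>Polar decomposition and singular vectors\<close>

text \<open>The defining equation is closed, and unit rows bound the norm. Compactness is used
  twice: for the polar factor and for the minimising rotation.\<close>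

lemma compact_orthogonal_matrices: "compact {U :: real^'r^'r. orthogonal_matrix U}"
proof -
  have "continuous_on UNIV (\<lambda>U :: real^'r^'r. transpose U ** U)"
    unfolding transpose_def matrix_matrix_mult_def by (simp, intro continuous_intros)
  then have "closed {U :: real^'r^'r. orthogonal_matrix U}"
    unfolding orthogonal_matrix by (intro closed_Collect_eq continuous_on_const)
  moreover have "norm U \<le> (\<Sum>i\<in>(UNIV :: 'r set). 1)" if "orthogonal_matrix U" for U :: "real^'r^'r"
  proof -
    have "norm (U $ i) = 1" for i
      using that unfolding orthogonal_matrix_orthonormal_rows by (simp add: row_def)
    then show ?thesis
      using L2_set_le_sum[of UNIV "\<lambda>i. norm (U $ i)"] by (simp add: norm_vec_def[of U])
  qed
  then have "bounded {U :: real^'r^'r. orthogonal_matrix U}"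
    by (intro boundedI) auto
  ultimately show ?thesis by (simp add: compact_eq_bounded_closed)
qed

definition outer :: "real^'r \<Rightarrow> real^'r \<Rightarrow> real^'r^'r" where
  "outer a b = (\<chi> i j. a $ i * b $ j)"

lemma outer_mult: "outer a b ** outer c d = (b \<bullet> c) *\<^sub>R outer a d"
  by (simp add: outer_def vec_eq_iff matrix_matrix_mult_def inner_vec_def sum_distrib_left
      sum_distrib_right mult_ac)

lemma trace_mult_outer: "trace (P ** outer a b) = b \<bullet> (P *v a)"
  by (simp add: outer_def trace_def matrix_matrix_mult_def inner_vec_def matrix_vector_mult_def
      sum_distrib_left mult_ac)

lemma trace_scaleR: "trace (c *\<^sub>R A) = c * trace A" for A :: "real^'r^'r"
  by (simp add: trace_def sum_distrib_left)

text \<open>The reflection in the hyperplane orthogonal to \<open>w\<close>. Multiplying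
  \<open>P\<close> by it changes the trace by a multiple of \<open>w \<bullet> (P *v w)\<close>,
  which makes reflections useful test matrices.\<close>

definition householder :: "real^'r \<Rightarrow> real^'r^'r" where
  "householder w = mat 1 - (2 / (w \<bullet> w)) *\<^sub>R outer w w"

lemma orthogonal_householder:
  assumes "w \<noteq> 0"
  shows "orthogonal_matrix (householder w)"
proof -
  have "transpose (householder w) = householder w"
    by (simp add: householder_def transpose_def vec_eq_iff outer_def mat_def mult.commute)
  moreover have "householder w ** householder w = mat 1"
    using assms
    by (simp add: householder_def matrix_diff_ldistrib matrix_diff_rdistrib scaleR_matrix_mult
        matrix_mult_scaleR outer_mult scaleR_2 scaleR_diff_right scaleR_add_right)
  ultimately show ?thesis by (simp add: orthogonal_matrix)
qed

text \<open>First-order optimality: a linear term cannot stay below a quadratic one for both signs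
  of \<open>t\<close>. Testing at \<open>t = k / L\<close> with \<open>L > 0\<close> and
  \<open>L > K\<close> gives \<open>k\<^sup>2 * (L - K) \<le> 0\<close>.\<close>

lemma linear_coeff_eq_0:
  fixes k K :: real
  assumes "\<And>t. k * t \<le> K * t\<^sup>2"
  shows "k = 0"
proof -
  define L where "L = \<bar>K\<bar> + 1"
  have L: "L > 0" "K < L" by (auto simp: L_def)
  have "k * (k / L) \<le> K * (k / L)\<^sup>2" by (rule assms)
  then have "k\<^sup>2 * L \<le> K * k\<^sup>2" using L by (simp add: field_simps power2_eq_square)
  then have "k\<^sup>2 * (L - K) \<le> 0" by (simp add: algebra_simps)
  then show ?thesis using L by (simp add: mult_le_0_iff)
qed

text \<open>Testing against single reflections gives semidefiniteness, against products of two
  nearby reflections symmetry.\<close>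

lemma trace_maximal_imp_symmetric_psd:
  fixes P :: "real^'r^'r"
  assumes max: "\<And>Q. orthogonal_matrix Q \<Longrightarrow> trace (P ** Q) \<le> trace P"
  shows "transpose P = P" and "0 \<le> w \<bullet> (P *v w)"
proof -
  show "0 \<le> w \<bullet> (P *v w)"
  proof (cases "w = 0")
    case False
    have "trace (P ** householder w) \<le> trace P"
      by (rule max[OF orthogonal_householder[OF False]])
    then have "0 \<le> 2 / (w \<bullet> w) * (w \<bullet> (P *v w))"
      by (simp add: householder_def matrix_diff_ldistrib matrix_mult_scaleR trace_sub trace_scaleR
          trace_mult_outer)
    moreover have "2 / (w \<bullet> w) > 0" using False by simp
    ultimately show ?thesis by (simp only: zero_le_mult_iff) linarith
  qed simp
  \<comment> \<open>Maximality against the product of the reflections along \<open>w\<close> and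
    \<open>z\<close>, multiplied by half of
    \<open>(w \<bullet> w) * (z \<bullet> z)\<close>.\<close>
  have two: "2 * (w \<bullet> z) * (z \<bullet> (P *v w)) \<le> (z \<bullet> z) * (w \<bullet> (P *v w)) + (w \<bullet> w) * (z \<bullet> (P *v z))"
    if nz: "w \<noteq> 0" "z \<noteq> 0" for w z
  proof -
    have "trace (P ** (householder w ** householder z)) \<le> trace P"
      by (intro max orthogonal_matrix_mul orthogonal_householder nz)
    then have "- (2 * (w \<bullet> (P *v w)) / (w \<bullet> w))
        \<le> (2 * (z \<bullet> (P *v z)) - w \<bullet> z * (4 * (z \<bullet> (P *v w))) / (w \<bullet> w)) / (z \<bullet> z)"
      by (simp add: householder_def matrix_diff_ldistrib matrix_diff_rdistrib scaleR_matrix_mult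
          matrix_mult_scaleR matrix_add_ldistrib outer_mult trace_add trace_sub trace_scaleR
          trace_mult_outer mult_ac)
    then have "4 * (w \<bullet> z) * (z \<bullet> (P *v w)) / ((w \<bullet> w) * (z \<bullet> z))
        \<le> 2 * (w \<bullet> (P *v w)) / (w \<bullet> w) + 2 * (z \<bullet> (P *v z)) / (z \<bullet> z)"
      by (simp add: diff_divide_distrib mult_ac)
    moreover have "w \<bullet> w > 0" "z \<bullet> z > 0" using nz by auto
    ultimately show ?thesis by (simp add: field_simps)
  qed
  have "y \<bullet> (P *v w) = w \<bullet> (P *v y)" for w y
  proof (cases "w = 0")
    case False
    define a b b' d p q m where
      "a = w \<bullet> (P *v w)" and "b = y \<bullet> (P *v w)" and "b' = w \<bullet> (P *v y)" and
      "d = y \<bullet> (P *v y)" and "p = w \<bullet> w" and "q = w \<bullet> y" and "m = y \<bullet> y"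
    \<comment> \<open>This is \<open>two\<close> for \<open>z = w + t *\<^sub>R y\<close>: the
      constant terms cancel, and the linear coefficient is the asymmetry of \<open>P\<close> times
      \<open>p\<close>. If \<open>z = 0\<close>, then \<open>w\<close> is a multiple of
      \<open>y\<close>, and both sides vanish.\<close>
    have "p * (b - b') * t \<le> (m * a + p * d - 2 * q * b) * t\<^sup>2" for t
    proof (cases "w + t *\<^sub>R y = 0")
      case True
      then have w: "w = (- t) *\<^sub>R y" by (simp add: add_eq_0_iff2)
      have eq: "b = b'"
        unfolding b_def b'_def w matrix_vector_mult_scaleR by simp
      have zero: "(m * a + p * d - 2 * q * b) * t\<^sup>2 = 0"
        unfolding m_def a_def p_def d_def q_def b_def w matrix_vector_mult_scaleR
        by (simp add: algebra_simps power2_eq_square)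
      show ?thesis unfolding zero by (simp add: eq)
    next
      case nz: False
      from two[OF False nz]
      have "2 * (p + t * q) * (a + t * b)
          \<le> (p + 2 * t * q + t\<^sup>2 * m) * a + p * (a + t * (b + b') + t\<^sup>2 * d)"
        by (simp add: a_def b_def b'_def d_def p_def q_def m_def inner_add_left inner_add_right
            matrix_vector_right_distrib matrix_vector_mult_scaleR inner_commute algebra_simps
            power2_eq_square)
      then show ?thesis by (simp add: algebra_simps power2_eq_square)
    qed
    then have "p * (b - b') = 0" by (rule linear_coeff_eq_0)
    then show ?thesis using False by (simp add: p_def b_def b'_def)
  qed simp
  then show "transpose P = P"
    by (intro symmetric_matrixI) (simp add: inner_commute)
qed

text \<open>Take \<open>U\<close> maximising \<open>trace (C ** U)\<close> over the orthogonal
  matrices. Every \<open>U ** Q\<close> with \<open>Q\<close> orthogonal is a competitor, so the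
  trace criterion applies to \<open>C ** U\<close>. No matrix square root is constructed, and
  \<open>C\<close> may be singular.\<close>

lemma polar_decomposition:
  fixes C :: "real^'r^'r"
  obtains U where "orthogonal_matrix U" "transpose (C ** U) = C ** U"
    "\<And>w. 0 \<le> w \<bullet> ((C ** U) *v w)"
proof -
  have "continuous_on {U :: real^'r^'r. orthogonal_matrix U} (\<lambda>U. trace (C ** U))"
    unfolding trace_def matrix_matrix_mult_def by (simp, intro continuous_intros)
  moreover have "{U :: real^'r^'r. orthogonal_matrix U} \<noteq> {}"
    using orthogonal_matrix_id by blast
  ultimately obtain U where U: "orthogonal_matrix U"
    and "\<And>U'. orthogonal_matrix U' \<Longrightarrow> trace (C ** U') \<le> trace (C ** U)"
    using continuous_attains_sup[OF compact_orthogonal_matrices] by blast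
  then have max: "trace ((C ** U) ** Q) \<le> trace (C ** U)" if "orthogonal_matrix Q" for Q
    unfolding matrix_mul_assoc[symmetric] by (simp add: orthogonal_matrix_mul U that)
  show thesis
    by (rule that[OF U trace_maximal_imp_symmetric_psd[OF max]])
qed

text \<open>For \<open>y = (I - P) x\<close> one has \<open>(I - P\<^sup>2) x = y + P y\<close>, whose norm is at least that of \<open>y\<close>.\<close>

lemma spectral_norm_id_minus_psd_le:
  fixes P :: "real^'r^'r"
  assumes psd: "\<And>w. 0 \<le> w \<bullet> (P *v w)"
  shows "spectral_norm (mat 1 - P) \<le> spectral_norm (mat 1 - P ** P)"
proof (rule spectral_norm_leI)
  fix x
  let ?y = "(mat 1 - P) *v x"
  have eq: "(mat 1 - P ** P) *v x = ?y + P *v ?y"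
    by (simp add: matrix_vector_mult_diff_rdistrib matrix_vector_mult_diff_distrib
        flip: matrix_vector_mul_assoc)
  have "(norm ?y)\<^sup>2 \<le> (norm (?y + P *v ?y))\<^sup>2"
    using psd[of ?y] inner_ge_zero[of "P *v ?y"]
    by (simp add: power2_norm_eq_inner inner_add_left inner_add_right inner_commute)
  then have "norm ?y \<le> norm ((mat 1 - P ** P) *v x)"
    unfolding eq by (rule power2_le_imp_le) simp
  then show "norm ?y \<le> spectral_norm (mat 1 - P ** P) * norm x"
    by (rule order_trans[OF _ norm_matrix_vector_le])
qed

text \<open>A maximiser \<open>x\<close> of \<open>norm (S *v x)\<close> on the unit sphere attains
  the spectral norm \<open>s\<close>. Then \<open>z = transpose S *v (S *v x)\<close> has norm at
  most \<open>s\<^sup>2\<close> while \<open>z \<bullet> x = s\<^sup>2\<close>, so equality holds in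
  Cauchy-Schwarz and \<open>z\<close> is a multiple of \<open>x\<close>.\<close>

lemma top_singular_vector:
  fixes S :: "real^'r^'s"
  obtains x where "norm x = 1" "transpose S *v (S *v x) = (spectral_norm S)\<^sup>2 *\<^sub>R x"
proof -
  let ?s = "spectral_norm S"
  obtain e :: "real^'r" where "norm e = 1" using vector_choose_size[of 1] by auto
  then have "sphere (0 :: real^'r) 1 \<noteq> {}" by auto
  moreover have "continuous_on (sphere 0 1) (\<lambda>x. norm (S *v x))"
    by (intro continuous_intros matrix_vector_mult_linear_continuous_on)
  ultimately obtain x where "x \<in> sphere 0 1"
    and "\<forall>y\<in>sphere 0 1. norm (S *v y) \<le> norm (S *v x)"
    using continuous_attains_sup[OF compact_sphere] by blast
  then have x: "norm x = 1" and "\<And>y. norm y = 1 \<Longrightarrow> norm (S *v y) \<le> norm (S *v x)"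
    by auto
  then have max: "norm (S *v sgn y) \<le> norm (S *v x)" if "y \<noteq> 0" for y
    using that by (simp add: norm_sgn)
  have "norm (S *v y) \<le> norm (S *v x) * norm y" for y
  proof (cases "y = 0")
    case False
    then show ?thesis
      using max[OF False] by (simp add: sgn_div_norm matrix_vector_mult_scaleR field_simps)
  qed simp
  then have Sx: "norm (S *v x) = ?s"
    using norm_matrix_vector_le[of S x] x spectral_norm_leI[of S "norm (S *v x)"] by auto
  define z where "z = transpose S *v (S *v x)"
  have "norm z \<le> ?s * ?s"
    unfolding z_def using norm_matrix_vector_le[of "transpose S" "S *v x"]
    by (simp add: Sx spectral_norm_transpose)
  then have "z \<bullet> z \<le> (?s\<^sup>2)\<^sup>2"
    by (metis norm_ge_zero power2_eq_square power2_norm_eq_inner power_mono)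
  moreover have "z \<bullet> x = ?s\<^sup>2"
    by (simp add: z_def inner_transpose_left dot_square_norm Sx)
  moreover have "x \<bullet> x = 1" using x by (simp add: dot_square_norm)
  ultimately have "(norm (z - ?s\<^sup>2 *\<^sub>R x))\<^sup>2 \<le> 0"
    by (simp add: power2_norm_eq_inner inner_diff_left inner_diff_right inner_commute
        power2_eq_square[of "?s\<^sup>2"])
  then have "z = ?s\<^sup>2 *\<^sub>R x" by simp
  then show thesis using that x by (simp add: z_def)
qed

section \<open>Dominant invariant subspaces\<close>

text \<open>Orthonormality makes the family injective and independent; having as many members as the
  dimension, it spans.\<close>

lemma orthonormal_family_expand:
  fixes v :: "'i \<Rightarrow> real^'n"
  assumes orth: "\<And>i j. i \<in> I \<Longrightarrow> j \<in> I \<Longrightarrow> v i \<bullet> v j = (if i = j then 1 else 0)"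
    and card: "card I = CARD('n)"
  shows "x = (\<Sum>i\<in>I. (x \<bullet> v i) *\<^sub>R v i)"
proof -
  have fin: "finite I" using card by (intro card_ge_0_finite) simp
  have inj: "inj_on v I"
  proof (rule inj_onI)
    fix i j assume "i \<in> I" "j \<in> I" "v i = v j"
    then show "i = j" using orth[of i j] orth[of j j] by (auto split: if_splits)
  qed
  have ortho: "pairwise orthogonal (v ` I)"
    using orth by (auto simp: pairwise_def orthogonal_def)
  have "v i \<noteq> 0" if "i \<in> I" for i using orth[OF that that] by auto
  then have "0 \<notin> v ` I" by fastforce
  with ortho have "independent (v ` I)" by (rule pairwise_orthogonal_independent)
  then have "UNIV \<subseteq> span (v ` I)"
    by (intro card_ge_dim_independent) (auto simp: card_image[OF inj] card)
  then have "x \<in> span (v ` I)" by blast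
  moreover have "norm b = 1" if "b \<in> v ` I" for b
    using that orth by (auto simp: norm_eq_1)
  ultimately have "(\<Sum>b\<in>v ` I. (x \<bullet> b) *\<^sub>R b) = x"
    by (intro orthonormal_basis_expand[OF ortho _ _ finite_imageI[OF fin]])
  then show ?thesis by (simp add: sum.reindex[OF inj] o_def)
qed

lemma orthonormal_family_inner:
  fixes v :: "'i \<Rightarrow> real^'n"
  assumes orth: "\<And>i j. i \<in> I \<Longrightarrow> j \<in> I \<Longrightarrow> v i \<bullet> v j = (if i = j then 1 else 0)"
    and card: "card I = CARD('n)"
  shows "x \<bullet> y = (\<Sum>i\<in>I. (x \<bullet> v i) * (v i \<bullet> y))"
proof -
  have "x \<bullet> y = (\<Sum>i\<in>I. (x \<bullet> v i) *\<^sub>R v i) \<bullet> y"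
    using orthonormal_family_expand[OF assms, of x] by (rule arg_cong)
  then show ?thesis by (simp only: inner_sum_left inner_scaleR_left)
qed

lemma dominant_invariant_subspaceE:
  fixes M :: "real^'n^'n"
  assumes "dominant_invariant_subspace r M S"
  obtains v \<mu> where
    "\<And>i j. i \<in> {1..CARD('n)} \<Longrightarrow> j \<in> {1..CARD('n)} \<Longrightarrow> v i \<bullet> v j = (if i = j then 1 else 0)"
    "\<And>i. i \<in> {1..CARD('n)} \<Longrightarrow> M *v v i = \<mu> i *\<^sub>R v i"
    "\<And>i j. i \<in> {1..CARD('n)} \<Longrightarrow> j \<in> {1..CARD('n)} \<Longrightarrow> i \<le> j \<Longrightarrow> \<mu> j \<le> \<mu> i"
    "S = span (v ` {1..r})"
proof -
  obtain v \<mu> where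
    "\<forall>i\<in>{1..CARD('n)}. \<forall>j\<in>{1..CARD('n)}. v i \<bullet> v j = (if i = j then 1 else 0)"
    "\<forall>i\<in>{1..CARD('n)}. M *v v i = \<mu> i *\<^sub>R v i"
    "\<forall>i\<in>{1..CARD('n)}. \<forall>j\<in>{1..CARD('n)}. i \<le> j \<longrightarrow> \<mu> j \<le> \<mu> i"
    "S = span (v ` {1..r})"
    using assms unfolding dominant_invariant_subspace_def
    by (elim exE conjE) (rule that; assumption)
  then show thesis by (intro that[of v \<mu>]) simp_all
qed

text \<open>The range is spanned by eigenvectors, so \<open>M\<close> maps it into itself, and
  \<open>V ** transpose V\<close> fixes every vector of it.\<close>

lemma dominant_invariant_subspace_invariant:
  assumes dom: "dominant_invariant_subspace r M (range ((*v) V))"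
    and orth: "transpose V ** V = mat 1" and r: "r \<le> CARD('n)"
  shows "M *v (V *v x) = V *v (transpose V *v ((M :: real^'n^'n) *v (V *v x)))"
proof -
  obtain v \<mu> where
    eig: "\<And>i. i \<in> {1..CARD('n)} \<Longrightarrow> M *v v i = \<mu> i *\<^sub>R v i"
    and S: "range ((*v) V) = span (v ` {1..r})"
    using dominant_invariant_subspaceE[OF dom] by metis
  have "M *v y \<in> span (v ` {1..r})" if "y \<in> span (v ` {1..r})" for y
    using that
  proof (induction rule: span_induct_alt)
    case (step c b z)
    then obtain i where "i \<in> {1..r}" "b = v i" by auto
    with r have "M *v b = \<mu> i *\<^sub>R b" using eig[of i] by simp
    moreover have "b \<in> span (v ` {1..r})" using step by (simp add: span_base)
    ultimately show ?case
      using step by (simp add: matrix_vector_right_distrib matrix_vector_mult_scaleR span_add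
          span_scale)
  qed (simp add: span_zero)
  moreover have "V *v x \<in> span (v ` {1..r})" unfolding S[symmetric] by simp
  ultimately have "M *v (V *v x) \<in> range ((*v) V)" unfolding S by blast
  then obtain z where z: "M *v (V *v x) = V *v z" by blast
  have "transpose V *v (V *v z) = z"
    by (simp add: matrix_vector_mul_assoc orth)
  then show ?thesis using z by simp
qed

text \<open>A Weyl-type bound: the hypothesis on \<open>W\<close> forces the \<open>r\<close>-th eigenvalue of \<open>M\<close> to be at
  least \<open>l\<close>.\<close>

lemma dominant_invariant_subspace_lower_bound:
  fixes V W :: "real^'r^'n"
  assumes dom: "dominant_invariant_subspace CARD('r) M (range ((*v) V))"
    and orthV: "transpose V ** V = mat 1" and r: "CARD('r) \<le> CARD('n)"
    and orthW: "transpose W ** W = mat 1"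
    and W: "\<And>x. l * (x \<bullet> x) \<le> (W *v x) \<bullet> (M *v (W *v x))"
  shows "l * (x \<bullet> x) \<le> (V *v x) \<bullet> (M *v (V *v x))"
proof -
  let ?I = "{1..CARD('n)}" and ?r = "CARD('r)"
  obtain v \<mu> where
    orth: "\<And>i j. i \<in> ?I \<Longrightarrow> j \<in> ?I \<Longrightarrow> v i \<bullet> v j = (if i = j then 1 else 0)"
    and eig: "\<And>i. i \<in> ?I \<Longrightarrow> M *v v i = \<mu> i *\<^sub>R v i"
    and ord: "\<And>i j. i \<in> ?I \<Longrightarrow> j \<in> ?I \<Longrightarrow> i \<le> j \<Longrightarrow> \<mu> j \<le> \<mu> i"
    and S: "range ((*v) V) = span (v ` {1..?r})"
    by (rule dominant_invariant_subspaceE[OF dom]) (rule that)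
  have rI: "?r \<in> ?I" using r by (simp add: Suc_le_eq)
  have card: "card ?I = CARD('n)" by simp
  have sq: "y \<bullet> y = (\<Sum>i\<in>?I. (y \<bullet> v i)\<^sup>2)" for y
    using orthonormal_family_inner[OF orth card, of y y]
    by (simp add: power2_eq_square inner_commute)
  have form: "y \<bullet> (M *v y) = (\<Sum>i\<in>?I. \<mu> i * (y \<bullet> v i)\<^sup>2)" for y
  proof -
    have "M *v y = M *v (\<Sum>i\<in>?I. (y \<bullet> v i) *\<^sub>R v i)"
      using orthonormal_family_expand[OF orth card, of y] by (rule arg_cong)
    also have "\<dots> = (\<Sum>i\<in>?I. (y \<bullet> v i) *\<^sub>R (M *v v i))"
      by (simp add: linear_sum[OF matrix_vector_mul_linear] o_def matrix_vector_mult_scaleR)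
    finally show ?thesis
      by (simp add: inner_sum_right eig power2_eq_square mult_ac)
  qed
  have le: "l \<le> \<mu> ?r"
  proof -
    \<comment> \<open>Fewer than \<open>CARD('r)\<close> vectors cannot span the coordinate space,
      so some nonzero \<open>y\<close> makes \<open>W *v y\<close> orthogonal to all eigenvectors
      before the \<open>r\<close>-th. On such a vector the form of \<open>M\<close> is at most
      \<open>\<mu> ?r\<close> times the squared norm.\<close>
    have "dim ((\<lambda>i. transpose W *v v i) ` {1..<?r}) \<le> card ((\<lambda>i. transpose W *v v i) ` {1..<?r})"
      by (rule dim_le_card') simp
    also have "\<dots> \<le> card {1..<?r}" by (rule card_image_le) simp
    also have "\<dots> < DIM(real^'r)" by simp
    finally obtain y where y: "y \<noteq> 0"
      and "\<And>z. z \<in> span ((\<lambda>i. transpose W *v v i) ` {1..<?r}) \<Longrightarrow> orthogonal y z"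
      by (rule orthogonal_to_subspace_exists) blast
    then have "y \<bullet> (transpose W *v v i) = 0" if "i \<in> {1..<?r}" for i
      using that unfolding orthogonal_def by (meson image_eqI span_base)
    then have zero: "(W *v y) \<bullet> v i = 0" if "i \<in> {1..<?r}" for i
      using that by (simp add: inner_transpose_right)
    have "\<mu> i * ((W *v y) \<bullet> v i)\<^sup>2 \<le> \<mu> ?r * ((W *v y) \<bullet> v i)\<^sup>2" if "i \<in> ?I" for i
    proof (cases "i < ?r")
      case False
      then show ?thesis using ord[OF rI that] by (simp add: mult_right_mono)
    qed (use zero that in simp)
    then have "(W *v y) \<bullet> (M *v (W *v y)) \<le> \<mu> ?r * ((W *v y) \<bullet> (W *v y))"
      unfolding form sq sum_distrib_left by (rule sum_mono)
    with W[of y] have "l * (y \<bullet> y) \<le> \<mu> ?r * (y \<bullet> y)"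
      by (simp add: dot_square_norm norm_orthonormal_columns[OF orthW])
    then show ?thesis using y by simp
  qed
  \<comment> \<open>Only coefficients with index at most \<open>r\<close> survive here, and their
    eigenvalues are at least \<open>\<mu> ?r\<close>, hence at least \<open>l\<close>.\<close>
  let ?y = "V *v x"
  have "?y \<in> span (v ` {1..?r})" using S by blast
  have zero: "?y \<bullet> v i = 0" if "i \<in> ?I" "?r < i" for i
  proof -
    have "orthogonal (v i) ?y"
      using \<open>?y \<in> span (v ` {1..?r})\<close>
    proof (rule orthogonal_to_span)
      fix b assume "b \<in> v ` {1..?r}"
      then obtain j where "j \<in> {1..?r}" "b = v j" by auto
      then show "orthogonal (v i) b" using that r orth[of i j] by (auto simp: orthogonal_def)
    qed
    then show ?thesis by (simp add: orthogonal_def inner_commute)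
  qed
  have "l * (?y \<bullet> v i)\<^sup>2 \<le> \<mu> i * (?y \<bullet> v i)\<^sup>2" if "i \<in> ?I" for i
  proof (cases "?r < i")
    case False
    then show ?thesis using le ord[OF that rI] by (intro mult_right_mono) auto
  qed (use zero that in simp)
  then have "l * (?y \<bullet> ?y) \<le> ?y \<bullet> (M *v ?y)"
    unfolding form sq sum_distrib_left by (rule sum_mono)
  then show ?thesis by (simp add: dot_square_norm norm_orthonormal_columns[OF orthV])
qed

text \<open>\<open>norm\<close> on matrices is the Frobenius norm, so a vanishing trace here forces
  the matrix to be zero.\<close>

lemma trace_transpose_mult_self: "trace (transpose G ** G) = (norm G)\<^sup>2" for G :: "real^'n^'n"
proof -
  have "trace (transpose G ** G) = (\<Sum>i\<in>UNIV. \<Sum>j\<in>UNIV. (G $ j $ i)\<^sup>2)"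
    by (simp add: trace_def matrix_matrix_mult_def transpose_def power2_eq_square)
  also have "\<dots> = (\<Sum>j\<in>UNIV. \<Sum>i\<in>UNIV. (G $ j $ i)\<^sup>2)" by (rule sum.swap)
  finally show ?thesis
    by (simp only: power2_norm_eq_inner) (simp add: inner_vec_def power2_eq_square)
qed

text \<open>The defect \<open>G\<close> is a symmetric idempotent whose trace is n - r - s = 0. Its
  squared Frobenius norm equals that trace, so \<open>G\<close> vanishes.\<close>

lemma complementary_orthonormal_columns:
  fixes V :: "real^'r^'n" and W :: "real^'s^'n"
  assumes card: "CARD('n) = CARD('r) + CARD('s)"
    and V: "transpose V ** V = mat 1" and W: "transpose W ** W = mat 1"
    and VW: "transpose V ** W = 0"
  shows "V ** transpose V + W ** transpose W = mat 1"
proof -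
  define G where "G = mat 1 - (V ** transpose V + W ** transpose W)"
  have WV: "transpose W ** V = 0"
  proof -
    have "transpose W ** V = transpose (transpose V ** W)" by (simp add: matrix_transpose_mul)
    also have "\<dots> = 0" unfolding VW by (simp add: transpose_def zero_vec_def vec_eq_iff)
    finally show ?thesis .
  qed
  have tr: "transpose G = G"
  proof (rule symmetric_matrixI)
    have "transpose (V ** transpose V) = V ** transpose V"
      "transpose (W ** transpose W) = W ** transpose W"
      by (simp_all add: matrix_transpose_mul)
    note this[THEN symmetric_inner]
    then show "(G *v x) \<bullet> y = x \<bullet> (G *v y)" for x y
      by (simp add: G_def matrix_vector_mult_diff_rdistrib matrix_vector_mult_add_rdistrib
          inner_diff_left inner_diff_right inner_add_left inner_add_right)
  qed
  have "(V ** transpose V) ** (V ** transpose V) = V ** (transpose V ** V) ** transpose V"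
    "(V ** transpose V) ** (W ** transpose W) = V ** (transpose V ** W) ** transpose W"
    "(W ** transpose W) ** (V ** transpose V) = W ** (transpose W ** V) ** transpose V"
    "(W ** transpose W) ** (W ** transpose W) = W ** (transpose W ** W) ** transpose W"
    by (simp_all only: matrix_mul_assoc)
  then have "G ** G = G"
    by (simp add: G_def matrix_diff_ldistrib matrix_diff_rdistrib matrix_add_ldistrib
        matrix_add_rdistrib V W VW WV)
  moreover have "trace G = 0"
    using card by (simp add: G_def trace_sub trace_add trace_I trace_mul_sym[of V] V
        trace_mul_sym[of W] W)
  ultimately have "(norm G)\<^sup>2 = 0"
    by (simp add: tr flip: trace_transpose_mult_self)
  then show ?thesis by (simp add: G_def)
qed

section \<open>Rotation onto the graph of the Riccati solution\<close>

text \<open>Test the Sylvester equation for the sines \<open>S = V2\<^sup>T Vhat\<close> against a top singular vector of \<open>S\<close>.\<close>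

lemma sin_theta_bound:
  fixes A E :: "real^'n^'n" and Vhat :: "real^'r^'n" and V2 :: "real^'s^'n"
  assumes V2: "transpose V2 ** V2 = mat 1" and Vhat: "transpose Vhat ** Vhat = mat 1"
    and V2_A: "transpose V2 ** A = \<Lambda>2 ** transpose V2"
    and upper: "\<And>u. u \<bullet> (\<Lambda>2 *v u) \<le> l2 * (u \<bullet> u)"
    and invariant: "\<And>x. (A + E) *v (Vhat *v x)
      = Vhat *v (transpose Vhat *v ((A + E) *v (Vhat *v x)))"
    and lower: "\<And>x. l1 * (x \<bullet> x) \<le> (Vhat *v x) \<bullet> ((A + E) *v (Vhat *v x))"
  shows "spectral_norm (transpose V2 ** Vhat) * (l1 - l2) \<le> spectral_norm E"
proof -
  define S where "S = transpose V2 ** Vhat"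
  let ?s = "spectral_norm S" and ?e = "spectral_norm E"
  obtain x where x: "norm x = 1" and sx: "transpose S *v (S *v x) = ?s\<^sup>2 *\<^sub>R x"
    by (rule top_singular_vector)
  have xx: "x \<bullet> x = 1" using x by (simp add: dot_square_norm)
  define m where "m = transpose Vhat *v ((A + E) *v (Vhat *v x))"
  have SS: "(S *v x) \<bullet> (S *v y) = ?s\<^sup>2 * (x \<bullet> y)" for y
    using inner_transpose_left[of S "S *v x" y] by (simp add: sx)
  have normS: "norm (S *v x) = ?s"
    using SS[of x] xx by (simp add: dot_square_norm spectral_norm_nonneg)
  \<comment> \<open>By invariance \<open>Vhat *v m\<close> equals
    \<open>(A + E) *v (Vhat *v x)\<close>, and \<open>V2_A\<close> moves \<open>A\<close> across
    \<open>transpose V2\<close>. Paired with \<open>S *v x\<close>, the left side is bounded below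
    through \<open>l1\<close> and the \<open>\<Lambda>2\<close> term above through
    \<open>l2\<close>.\<close>
  have "S *v m = transpose V2 *v ((A + E) *v (Vhat *v x))"
    using invariant[of x] by (simp add: S_def m_def flip: matrix_vector_mul_assoc)
  also have "\<dots> = transpose V2 *v (A *v (Vhat *v x)) + transpose V2 *v (E *v (Vhat *v x))"
    by (simp add: matrix_vector_mult_add_rdistrib matrix_vector_right_distrib)
  also have "transpose V2 *v (A *v (Vhat *v x)) = \<Lambda>2 *v (S *v x)"
    by (simp add: S_def matrix_vector_mul_assoc V2_A matrix_mul_assoc)
  finally have "?s\<^sup>2 * (x \<bullet> m)
      = (S *v x) \<bullet> (\<Lambda>2 *v (S *v x)) + (S *v x) \<bullet> (transpose V2 *v (E *v (Vhat *v x)))"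
    by (simp add: SS[symmetric] inner_add_right)
  moreover have "?s\<^sup>2 * l1 \<le> ?s\<^sup>2 * (x \<bullet> m)"
    using lower[of x] xx by (intro mult_left_mono) (simp_all add: m_def inner_transpose_right)
  moreover have "(S *v x) \<bullet> (\<Lambda>2 *v (S *v x)) \<le> l2 * ?s\<^sup>2"
    using upper[of "S *v x"] by (simp add: SS xx)
  moreover have "(S *v x) \<bullet> (transpose V2 *v (E *v (Vhat *v x))) \<le> ?s * ?e"
  proof -
    have "norm (transpose V2 *v (E *v (Vhat *v x))) \<le> 1 * (?e * 1)"
      using norm_matrix_vector_le[of "transpose V2" "E *v (Vhat *v x)"]
        norm_matrix_vector_le[of E "Vhat *v x"] x
        spectral_norm_orthonormal_columns[OF V2]
        mult_right_mono[of "spectral_norm V2" 1 "norm (E *v (Vhat *v x))"]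
      by (simp add: spectral_norm_transpose norm_orthonormal_columns[OF Vhat])
    then show ?thesis
      using norm_cauchy_schwarz[of "S *v x" "transpose V2 *v (E *v (Vhat *v x))"]
        mult_left_mono[of "norm (transpose V2 *v (E *v (Vhat *v x)))" ?e ?s]
      by (simp add: normS spectral_norm_nonneg)
  qed
  ultimately have "?s\<^sup>2 * l1 \<le> l2 * ?s\<^sup>2 + ?s * ?e" by linarith
  then have "?s * (?s * (l1 - l2)) \<le> ?s * ?e" by (simp add: algebra_simps power2_eq_square)
  then have "?s * (l1 - l2) \<le> ?e"
    using spectral_norm_nonneg[of S] spectral_norm_nonneg[of E]
    by (cases "?s = 0") (simp_all add: mult_le_cancel_left)
  then show ?thesis by (simp add: S_def)
qed

text \<open>\<open>U\<close> is the polar factor of \<open>V1\<^sup>T Vhat\<close>, and \<open>P\<close> is \<open>(I + X\<^sup>T X)\<^bsup>-1/2\<^esup>\<close>.\<close>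

lemma graph_representation:
  fixes V1 Vhat :: "real^'r^'n" and V2 :: "real^'s^'n"
  assumes V1: "transpose V1 ** V1 = mat 1" and Vhat: "transpose Vhat ** Vhat = mat 1"
    and complete: "V1 ** transpose V1 + V2 ** transpose V2 = mat 1"
    and small: "spectral_norm (transpose V2 ** Vhat) \<le> 1/4"
  obtains U P Pinv :: "real^'r^'r" and X :: "real^'r^'s"
  where "orthogonal_matrix U" "Vhat ** U = (V1 + V2 ** X) ** P" "P ** Pinv = mat 1"
    "spectral_norm P \<le> 1" "spectral_norm (P - mat 1) \<le> (spectral_norm X)\<^sup>2"
    "spectral_norm X \<le> 4/3 * spectral_norm (transpose V2 ** Vhat)"
proof -
  define C where "C = transpose V1 ** Vhat"
  obtain U where U: "orthogonal_matrix U" and sym: "transpose (C ** U) = C ** U"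
    and psd: "\<And>w. 0 \<le> w \<bullet> ((C ** U) *v w)"
    by (rule polar_decomposition[of C]) (rule that)
  define P where "P = C ** U"
  define T where "T = transpose V2 ** Vhat ** U"
  define W where "W = Vhat ** U"
  let ?s = "spectral_norm (transpose V2 ** Vhat)"
  have UU: "transpose U ** U = mat 1" using U by (simp add: orthogonal_matrix)
  have "transpose W ** W = transpose U ** (transpose Vhat ** Vhat) ** U"
    by (simp add: W_def matrix_transpose_mul matrix_mul_assoc)
  then have WW: "transpose W ** W = mat 1" by (simp add: Vhat UU)
  have PW: "P = transpose V1 ** W" and TW: "T = transpose V2 ** W"
    by (simp_all add: P_def C_def W_def T_def matrix_mul_assoc)
  \<comment> \<open>The resolution of the identity splits the rotated basis into a cosine part
    \<open>P\<close> and a sine part \<open>T\<close>; orthonormality of \<open>W\<close> then gives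
    \<open>mat 1 - P ** P = transpose T ** T\<close>.\<close>
  have "W = (V1 ** transpose V1 + V2 ** transpose V2) ** W" by (simp add: complete)
  then have W: "W = V1 ** P + V2 ** T"
    by (simp add: PW TW matrix_add_rdistrib matrix_mul_assoc)
  have Ts: "spectral_norm T \<le> ?s"
    using spectral_norm_mult_le[OF order_refl spectral_norm_orthogonal[OF U], of "transpose V2 ** Vhat"]
    by (simp add: T_def)
  have P1: "spectral_norm P \<le> 1"
    using spectral_norm_mult_le[of "transpose V1" 1 W 1] WW V1
    by (simp add: PW spectral_norm_transpose spectral_norm_orthonormal_columns)
  have "P ** P = transpose P ** P" using sym by (simp add: P_def)
  also have "\<dots> = transpose W ** (V1 ** transpose V1) ** W"
    by (simp add: PW matrix_transpose_mul matrix_mul_assoc)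
  also have "V1 ** transpose V1 = mat 1 - V2 ** transpose V2"
    using complete by (simp add: eq_diff_eq)
  finally have "mat 1 - P ** P = transpose T ** T"
    by (simp add: matrix_diff_ldistrib matrix_diff_rdistrib WW TW matrix_transpose_mul
        matrix_mul_assoc)
  then have "spectral_norm (mat 1 - P) \<le> spectral_norm (transpose T ** T)"
    using spectral_norm_id_minus_psd_le[of P] psd by (simp add: P_def)
  also have "\<dots> \<le> (spectral_norm T)\<^sup>2"
    using spectral_norm_mult[of "transpose T" T]
    by (simp add: spectral_norm_transpose power2_eq_square)
  finally have IP: "spectral_norm (mat 1 - P) \<le> (spectral_norm T)\<^sup>2" .
  also have "\<dots> \<le> (1/4)\<^sup>2"
    using Ts small by (intro power_mono spectral_norm_nonneg) simp
  finally have IP16: "spectral_norm (mat 1 - P) \<le> 1/16" by (simp add: power2_eq_square)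
  \<comment> \<open>Being within 1/16 of the identity, \<open>P\<close> shrinks no vector below
    15/16 of its length. This yields both the inverse and its bound 16/15.\<close>
  have lower: "norm y \<le> 16/15 * norm (P *v y)" for y
  proof -
    have "norm y = norm (P *v y + (mat 1 - P) *v y)" by (simp add: matrix_vector_mult_diff_rdistrib)
    also have "\<dots> \<le> norm (P *v y) + 1/16 * norm y"
      using norm_triangle_ineq[of "P *v y" "(mat 1 - P) *v y"]
        norm_matrix_vector_le[of "mat 1 - P" y] mult_right_mono[OF IP16, of "norm y"] by simp
    finally show ?thesis by simp
  qed
  have "y = 0" if "P *v y = 0" for y using lower[of y] that by simp
  then obtain Pinv where "Pinv ** P = mat 1"
    using matrix_left_invertible_ker[of P] by blast
  then have PPinv: "P ** Pinv = mat 1" by (simp add: matrix_left_right_inverse)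
  have Pinv: "spectral_norm Pinv \<le> 16/15"
    using lower[of "Pinv *v _"] by (intro spectral_norm_leI) (simp add: matrix_vector_mul_assoc PPinv)
  define X where "X = T ** Pinv"
  have XP: "X ** P = T"
    using \<open>Pinv ** P = mat 1\<close> by (simp add: X_def flip: matrix_mul_assoc)
  have "spectral_norm X \<le> ?s * (16/15)"
    unfolding X_def by (rule spectral_norm_mult_le[OF Ts Pinv])
  also have "\<dots> \<le> 4/3 * ?s" using spectral_norm_nonneg[of "transpose V2 ** Vhat"] by simp
  finally have X: "spectral_norm X \<le> 4/3 * ?s" .
  \<comment> \<open>Since \<open>T = X ** P\<close> with \<open>P\<close> a contraction, the bound
    on \<open>P - mat 1\<close> in terms of \<open>T\<close> also holds in terms of
    \<open>X\<close>.\<close>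
  have "spectral_norm T \<le> spectral_norm X"
    using spectral_norm_mult_le[OF order_refl P1, of X] by (simp add: XP)
  then have "(spectral_norm T)\<^sup>2 \<le> (spectral_norm X)\<^sup>2"
    by (intro power_mono spectral_norm_nonneg)
  moreover have "spectral_norm (P - mat 1) = spectral_norm (mat 1 - P)"
    using spectral_norm_scaleR[of "-1" "mat 1 - P"] by simp
  ultimately have PI: "spectral_norm (P - mat 1) \<le> (spectral_norm X)\<^sup>2" using IP by simp
  have "Vhat ** U = (V1 + V2 ** X) ** P"
    using W by (simp add: W_def matrix_add_rdistrib XP flip: matrix_mul_assoc)
  from that[OF U this PPinv P1 PI X] show thesis .
qed

text \<open>The columns of \<open>Y = V1 + V2 ** X\<close> span the invariant subspace, so
  \<open>(A + E) ** Y = Y ** K\<close>. Multiplying by \<open>transpose V1\<close> determines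
  \<open>K\<close>; multiplying by \<open>transpose V2\<close> and eliminating \<open>K\<close>
  leaves the Riccati equation.\<close>

lemma graph_riccati:
  fixes V1 W :: "real^'r^'n" and V2 :: "real^'s^'n" and X :: "real^'r^'s"
  assumes V1: "transpose V1 ** V1 = mat 1" and V2: "transpose V2 ** V2 = mat 1"
    and V12: "transpose V1 ** V2 = 0" and V21: "transpose V2 ** V1 = 0"
    and V1_A: "transpose V1 ** A = \<Lambda>1 ** transpose V1"
    and V2_A: "transpose V2 ** A = \<Lambda>2 ** transpose V2"
    and W: "W = (V1 + V2 ** X) ** P" "P ** Pinv = mat 1"
    and invariant: "(A + E) ** W = W ** M"
  shows "X ** \<Lambda>1 - \<Lambda>2 ** X
    = block V2 V1 E + block V2 V2 E ** X - X ** block V1 V1 E - X ** (block V1 V2 E ** X)"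
proof -
  define Y K where "Y = V1 + V2 ** X" and "K = P ** M ** Pinv"
  have "(A + E) ** (W ** Pinv) = W ** M ** Pinv"
    by (simp add: matrix_mul_assoc invariant)
  moreover have "W ** Pinv = Y"
    using W by (simp add: Y_def flip: matrix_mul_assoc)
  moreover have "W ** M ** Pinv = Y ** K"
    unfolding W(1) by (simp add: Y_def K_def matrix_mul_assoc)
  ultimately have YK: "(A + E) ** Y = Y ** K" by simp
  have V1Y: "transpose V1 ** Y = mat 1" and V2Y: "transpose V2 ** Y = X"
    by (simp_all add: Y_def matrix_add_ldistrib matrix_mul_assoc V1 V12 V21 V2)
  have "transpose V1 ** ((A + E) ** Y) = \<Lambda>1 ** (transpose V1 ** Y) + transpose V1 ** E ** Y"
    by (simp add: matrix_add_rdistrib matrix_add_ldistrib matrix_mul_assoc V1_A)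
  also have "\<dots> = \<Lambda>1 + transpose V1 ** E ** Y" by (simp add: V1Y)
  finally have "K = \<Lambda>1 + transpose V1 ** E ** Y"
    by (simp add: YK matrix_mul_assoc V1Y)
  moreover have "transpose V2 ** ((A + E) ** Y) = \<Lambda>2 ** (transpose V2 ** Y) + transpose V2 ** E ** Y"
    by (simp add: matrix_add_rdistrib matrix_add_ldistrib matrix_mul_assoc V2_A)
  then have "X ** K = \<Lambda>2 ** X + transpose V2 ** E ** Y"
    by (simp add: YK V2Y matrix_mul_assoc)
  ultimately have "X ** \<Lambda>1 + X ** (transpose V1 ** E ** Y) = \<Lambda>2 ** X + transpose V2 ** E ** Y"
    by (simp add: matrix_add_ldistrib)
  moreover have "transpose V1 ** E ** Y = block V1 V1 E + block V1 V2 E ** X"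
    "transpose V2 ** E ** Y = block V2 V1 E + block V2 V2 E ** X"
    by (simp_all add: Y_def block_def matrix_add_ldistrib matrix_mul_assoc)
  ultimately show ?thesis
    by (simp add: matrix_add_ldistrib algebra_simps)
qed

section \<open>The perturbation bound\<close>

lemma diag_matrix_mult_right: "(Z ** diag_matrix d) $ i $ j = Z $ i $ j * d j"
  by (simp add: matrix_matrix_mult_def diag_matrix_def if_distrib cong: if_cong)

lemma diag_matrix_mult_left: "(diag_matrix d ** Z) $ i $ j = d i * Z $ i $ j"
  by (simp add: matrix_matrix_mult_def diag_matrix_def if_distrib[of "\<lambda>x. x * _"] cong: if_cong)

lemma diag_matrix_vector_mult: "(diag_matrix d *v x) $ i = d i * x $ i"
  by (simp add: matrix_vector_mult_def diag_matrix_def if_distrib[of "\<lambda>x. x * _"] cong: if_cong)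

lemma inner_diag_matrix: "x \<bullet> (diag_matrix d *v x) = (\<Sum>i\<in>UNIV. d i * (x $ i * x $ i))"
  by (simp add: inner_vec_def diag_matrix_vector_mult mult_ac)

lemma inner_diag_matrix_lower:
  "(\<And>i. c \<le> d i) \<Longrightarrow> c * (x \<bullet> x) \<le> x \<bullet> (diag_matrix d *v x)"
  unfolding inner_diag_matrix unfolding inner_vec_def sum_distrib_left
  by (auto intro!: sum_mono mult_right_mono)

lemma inner_diag_matrix_upper:
  "(\<And>i. d i \<le> c) \<Longrightarrow> x \<bullet> (diag_matrix d *v x) \<le> c * (x \<bullet> x)"
  unfolding inner_diag_matrix unfolding inner_vec_def sum_distrib_left
  by (auto intro!: sum_mono mult_right_mono)

text \<open>The matrix unit at position \<open>(i, j)\<close> is an eigenvector of the Sylvester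
  operator with eigenvalue \<open>d j - d' i\<close>.\<close>

lemma sep_diag_matrix_le:
  fixes d :: "'l::finite \<Rightarrow> real" and d' :: "'m::finite \<Rightarrow> real"
  shows "sep spectral_norm (diag_matrix d) (diag_matrix d') \<le> \<bar>d j - d' i\<bar>"
proof -
  define Z :: "real^'l^'m" where "Z = (\<chi> a b. if a = i \<and> b = j then 1 else 0)"
  have "Z ** diag_matrix d - diag_matrix d' ** Z = (d j - d' i) *\<^sub>R Z"
    by (auto simp: vec_eq_iff diag_matrix_mult_left diag_matrix_mult_right Z_def)
  then have "sep spectral_norm (diag_matrix d) (diag_matrix d') * spectral_norm Z
      \<le> \<bar>d j - d' i\<bar> * spectral_norm Z"
    using sep_le[OF spectral_norm_scaleR spectral_norm_nonneg, of "diag_matrix d" "diag_matrix d'" Z]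
    by (simp add: spectral_norm_scaleR)
  moreover have "Z \<noteq> 0" by (auto simp: vec_eq_iff Z_def)
  then have "spectral_norm Z > 0"
    using spectral_norm_nonneg[of Z] spectral_norm_eq_0[of Z] by linarith
  ultimately show ?thesis by simp
qed

text \<open>Serves to derive the mutual orthogonality of \<open>V1\<close> and \<open>V2\<close>
  from the strict eigenvalue gap.\<close>

lemma distinct_eigenvectors_orthogonal:
  fixes A :: "real^'n^'n" and V :: "real^'r^'n" and W :: "real^'s^'n"
  assumes sym: "transpose A = A"
    and V: "\<And>i. A *v column i V = c i *\<^sub>R column i V"
    and W: "\<And>j. A *v column j W = d j *\<^sub>R column j W"
    and ne: "\<And>i j. c i \<noteq> d j"
  shows "transpose V ** W = 0"
proof -
  have "column i V \<bullet> column j W = 0" for i j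
  proof -
    have "c i * (column i V \<bullet> column j W) = d j * (column i V \<bullet> column j W)"
      using symmetric_inner[OF sym, of "column i V" "column j W"] by (simp add: V W)
    then show ?thesis using ne[of i j] by simp
  qed
  then show ?thesis
    by (simp add: vec_eq_iff matrix_matrix_mult_def transpose_def column_def inner_vec_def)
qed

lemma argmin_two_inf_norm_orthogonal_exists:
  fixes V W :: "real^'r^'n"
  shows "\<exists>U. is_arg_min (\<lambda>U. two_inf_norm (V ** U - W)) orthogonal_matrix U"
proof -
  have "continuous_on S (\<lambda>U. V ** U)" for S :: "(real^'r^'r) set"
    unfolding matrix_matrix_mult_def by (intro continuous_intros)
  then have "continuous_on S (\<lambda>U. norm (row i (V ** U - W)))" for S :: "(real^'r^'r) set" and i
    unfolding row_def by (intro continuous_intros) simp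
  then have "continuous_on {U. orthogonal_matrix U} (\<lambda>U. two_inf_norm (V ** U - W))"
    unfolding two_inf_norm_def by (intro continuous_on_Max_finite) auto
  moreover have "{U :: real^'r^'r. orthogonal_matrix U} \<noteq> {}"
    using orthogonal_matrix_id by blast
  ultimately obtain U :: "real^'r^'r" where "orthogonal_matrix U"
    "\<forall>U'\<in>{U. orthogonal_matrix U}. two_inf_norm (V ** U - W) \<le> two_inf_norm (V ** U' - W)"
    using continuous_attains_inf[OF compact_orthogonal_matrices] by blast
  then show ?thesis unfolding is_arg_min_def by (intro exI[of _ U]) force
qed

text \<open>Separation bounds the left side of the Riccati equation from below. On the right,
  \<open>E\<close> is small enough for terms containing \<open>X\<close> to be absorbed. In the
  row-wise bound the term with \<open>block V2 V2 E\<close> is not absorbed but estimated by the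
  spectral bound on \<open>X\<close>, which produces the product term.\<close>

lemma riccati_bounds:
  fixes V1 :: "real^'r^'n" and V2 :: "real^'s^'n" and X :: "real^'r^'s"
    and \<Lambda>1 :: "real^'r^'r" and \<Lambda>2 :: "real^'s^'s"
  defines "\<delta> \<equiv> sep spectral_norm \<Lambda>1 \<Lambda>2"
    and "\<gamma> \<equiv> sep_on two_inf_norm V2 \<Lambda>1 (V2 ** \<Lambda>2 ** transpose V2)"
  assumes V1: "transpose V1 ** V1 = mat 1" and V2: "transpose V2 ** V2 = mat 1"
    and riccati: "X ** \<Lambda>1 - \<Lambda>2 ** X
      = block V2 V1 E + block V2 V2 E ** X - X ** block V1 V1 E - X ** (block V1 V2 E ** X)"
    and X: "spectral_norm X \<le> 1/3"
    and g: "0 < g" "g \<le> \<delta>" "g \<le> \<gamma>" and E: "spectral_norm E \<le> g / 5"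
  shows "spectral_norm X \<le> 2 * (spectral_norm (block V2 V1 E) / \<delta>)"
    and "two_inf_norm (V2 ** X) \<le> 2 * (two_inf_norm (V2 ** block V2 V1 E) / g)
      + 4 * ((two_inf_norm (V2 ** block V2 V2 E ** transpose V2)
          * spectral_norm (block V2 V1 E)) / (g * \<delta>))"
proof -
  define a x y \<alpha> \<beta> where "a = spectral_norm (block V2 V1 E)" and "x = spectral_norm X"
    and "y = two_inf_norm (V2 ** X)" and "\<alpha> = two_inf_norm (V2 ** block V2 V1 E)"
    and "\<beta> = two_inf_norm (V2 ** block V2 V2 E ** transpose V2)"
  have x: "0 \<le> x" "x \<le> 1/3" and y: "0 \<le> y" and a: "0 \<le> a" and \<beta>: "0 \<le> \<beta>"
    using X by (simp_all add: x_def y_def a_def \<beta>_def spectral_norm_nonneg two_inf_norm_nonneg)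
  have \<delta>: "0 < \<delta>" using g by simp
  have blocks: "spectral_norm (block V1 V1 E) \<le> g / 5" "spectral_norm (block V1 V2 E) \<le> g / 5"
    "spectral_norm (block V2 V2 E) \<le> g / 5"
    using E spectral_norm_block_le[OF V1 V1, of E] spectral_norm_block_le[OF V1 V2, of E]
      spectral_norm_block_le[OF V2 V2, of E] by linarith+
  have E12X: "spectral_norm (block V1 V2 E ** X) \<le> g / 5 * (1/3)"
    by (rule spectral_norm_mult_le[OF blocks(2) X])
  have "\<delta> * x \<le> spectral_norm (X ** \<Lambda>1 - \<Lambda>2 ** X)"
    unfolding \<delta>_def x_def by (rule sep_le[OF spectral_norm_scaleR spectral_norm_nonneg])
  also have "\<dots> \<le> a + spectral_norm (block V2 V2 E ** X) + spectral_norm (X ** block V1 V1 E)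
      + spectral_norm (X ** (block V1 V2 E ** X))"
    unfolding riccati a_def
    by (intro order_trans[OF spectral_norm_diff] order_trans[OF spectral_norm_triangle] add_mono
        order_refl)
  also have "\<dots> \<le> a + g / 5 * x + x * (g / 5) + x * (g / 5 * (1/3))"
    unfolding x_def by (intro add_mono spectral_norm_mult_le blocks E12X order_refl)
  \<comment> \<open>Here 7/15 = 1/5 + 1/5 + 1/15, the last from
    \<open>spectral_norm X \<le> 1/3\<close>. What remains on the left is 8/15, and 15/8 is rounded
    up to 2.\<close>
  also have "\<dots> = a + 7/15 * (g * x)" by simp
  also have "\<dots> \<le> a + 7/15 * (\<delta> * x)" using g x by (simp add: mult_right_mono)
  finally have \<delta>x: "\<delta> * x \<le> 2 * a" using a by simp
  then have xb: "x \<le> 2 * (a / \<delta>)" using \<delta> by (simp add: field_simps)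
  then show "spectral_norm X \<le> 2 * (spectral_norm (block V2 V1 E) / \<delta>)"
    by (simp add: x_def a_def)
  \<comment> \<open>Inserting \<open>transpose V2 ** V2 = mat 1\<close> produces a Sylvester
    equation for \<open>V2 ** X\<close>, whose columns lie in the range of \<open>V2\<close> as the
    restricted separation requires.\<close>
  have "(V2 ** X) ** \<Lambda>1 - (V2 ** \<Lambda>2 ** transpose V2) ** (V2 ** X)
      = V2 ** (X ** \<Lambda>1) - V2 ** \<Lambda>2 ** (transpose V2 ** V2) ** X"
    by (simp only: matrix_mul_assoc)
  also have "\<dots> = V2 ** (X ** \<Lambda>1 - \<Lambda>2 ** X)"
    by (simp add: V2 matrix_diff_ldistrib matrix_mul_assoc)
  also have "\<dots> = V2 ** block V2 V1 E
      + V2 ** block V2 V2 E ** (transpose V2 ** V2) ** X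
      - (V2 ** X) ** block V1 V1 E - (V2 ** X) ** (block V1 V2 E ** X)"
    by (simp add: riccati V2 matrix_add_ldistrib matrix_diff_ldistrib matrix_mul_assoc)
  \<comment> \<open>Regrouped so that the left factor carries the (2,infinity)-norm and
    \<open>V2 ** X\<close> is measured in the spectral norm.\<close>
  also have "V2 ** block V2 V2 E ** (transpose V2 ** V2) ** X
      = (V2 ** block V2 V2 E ** transpose V2) ** (V2 ** X)"
    by (simp only: matrix_mul_assoc)
  finally have eq: "(V2 ** X) ** \<Lambda>1 - (V2 ** \<Lambda>2 ** transpose V2) ** (V2 ** X)
      = V2 ** block V2 V1 E + (V2 ** block V2 V2 E ** transpose V2) ** (V2 ** X)
      - (V2 ** X) ** block V1 V1 E - (V2 ** X) ** (block V1 V2 E ** X)" .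
  have V2X: "spectral_norm (V2 ** X) \<le> 1 * x"
    unfolding x_def
    by (rule spectral_norm_mult_le[OF spectral_norm_orthonormal_columns[OF V2] order_refl])
  have "g * y \<le> \<gamma> * y" using g y by (simp add: mult_right_mono)
  also have "\<dots> \<le> two_inf_norm ((V2 ** X) ** \<Lambda>1 - (V2 ** \<Lambda>2 ** transpose V2) ** (V2 ** X))"
    unfolding \<gamma>_def y_def
    by (rule sep_on_le) (auto simp: two_inf_norm_scaleR two_inf_norm_nonneg matrix_mult_column)
  also have "\<dots> \<le> \<alpha> + two_inf_norm ((V2 ** block V2 V2 E ** transpose V2) ** (V2 ** X))
      + two_inf_norm ((V2 ** X) ** block V1 V1 E)
      + two_inf_norm ((V2 ** X) ** (block V1 V2 E ** X))"
    unfolding eq \<alpha>_def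
    by (intro order_trans[OF two_inf_norm_diff] order_trans[OF two_inf_norm_triangle] add_mono
        order_refl)
  also have "\<dots> \<le> \<alpha> + \<beta> * (1 * x) + y * (g / 5) + y * (g / 5 * (1/3))"
    unfolding y_def \<beta>_def
    by (intro add_mono two_inf_norm_mult_le blocks E12X V2X order_refl)
  \<comment> \<open>Only 1/5 + 1/15 is absorbed this time, leaving 11/15 on the left; 15/11 is again
    rounded up to 2.\<close>
  also have "\<dots> = \<alpha> + \<beta> * x + 4/15 * (g * y)" by simp
  finally have "11/15 * (g * y) \<le> \<alpha> + \<beta> * x" by simp
  moreover have "0 \<le> g * y" using g y by simp
  ultimately have "g * y \<le> 2 * \<alpha> + 2 * (\<beta> * x)" by linarith
  also have "\<dots> \<le> 2 * \<alpha> + 2 * (\<beta> * (2 * (a / \<delta>)))"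
    by (intro add_left_mono mult_left_mono xb \<beta>) simp
  finally have "y \<le> (2 * \<alpha> + 2 * (\<beta> * (2 * (a / \<delta>)))) / g"
    using g by (simp add: field_simps)
  also have "\<dots> = 2 * (\<alpha> / g) + 4 * ((\<beta> * a) / (g * \<delta>))"
    using g \<delta> by (simp add: field_simps)
  finally show "two_inf_norm (V2 ** X) \<le> 2 * (two_inf_norm (V2 ** block V2 V1 E) / g)
      + 4 * ((two_inf_norm (V2 ** block V2 V2 E ** transpose V2)
          * spectral_norm (block V2 V1 E)) / (g * \<delta>))"
    by (simp add: y_def \<alpha>_def \<beta>_def a_def)
qed

theorem corollary3p2:
  fixes A E Ahat :: "real^'n^'n"
    and V1 V1hat :: "real^'r^'n"
    and V2 :: "real^'s^'n"
    and lam :: "nat \<Rightarrow> real"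
    and e1 :: "'r \<Rightarrow> nat"
    and e2 :: "'s \<Rightarrow> nat"
    and \<Lambda>1 :: "real^'r^'r"
    and \<Lambda>2 :: "real^'s^'s"
    and gap :: real
  assumes dims: "CARD('n) = CARD('r) + CARD('s)"
    and e1: "bij_betw e1 UNIV {1..CARD('r)}"
    and e2: "bij_betw e2 UNIV {CARD('r) + 1..CARD('n)}"
    and ordered: "\<And>i j. 1 \<le> i \<Longrightarrow> i \<le> j \<Longrightarrow> j \<le> CARD('n) \<Longrightarrow> lam j \<le> lam i"
    and eigengap: "lam (CARD('r)) > lam (CARD('r) + 1)"
    and \<Lambda>1: "\<Lambda>1 = diag_matrix (\<lambda>i. lam (e1 i))"
    and \<Lambda>2: "\<Lambda>2 = diag_matrix (\<lambda>i. lam (e2 i))"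
    and A_sym: "transpose A = A"
    and A_decomp: "A = V1 ** \<Lambda>1 ** transpose V1 + V2 ** \<Lambda>2 ** transpose V2"
    and V1_orthonormal: "transpose V1 ** V1 = mat 1"
    and V2_orthonormal: "transpose V2 ** V2 = mat 1"
    and V1_eigenvectors: "\<And>i. A *v column i V1 = lam (e1 i) *\<^sub>R column i V1"
    and V2_eigenvectors: "\<And>i. A *v column i V2 = lam (e2 i) *\<^sub>R column i V2"
    and E_sym: "transpose E = E"
    and Ahat: "Ahat = A + E"
    and gap: "gap = min (sep spectral_norm \<Lambda>1 \<Lambda>2)
                        (sep_on two_inf_norm V2 \<Lambda>1 (V2 ** \<Lambda>2 ** transpose V2))"
    and E_small: "spectral_norm E \<le> gap / 5"
    and V1hat_orthonormal: "transpose V1hat ** V1hat = mat 1"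
    and V1hat_range: "dominant_invariant_subspace (CARD('r)) Ahat (range ((*v) V1hat))"
  shows "\<exists>U :: real^'r^'r.
           is_arg_min (\<lambda>U. two_inf_norm (V1hat ** U - V1)) orthogonal_matrix U \<and>
           two_inf_norm (V1hat ** U - V1)
             \<le> 8 * two_inf_norm V1
                  * (spectral_norm (block V2 V1 E) / sep spectral_norm \<Lambda>1 \<Lambda>2)\<^sup>2
               + 2 * (two_inf_norm (V2 ** block V2 V1 E) / gap)
               + 4 * ((two_inf_norm (V2 ** block V2 V2 E ** transpose V2)
                        * spectral_norm (block V2 V1 E))
                      / (gap * sep spectral_norm \<Lambda>1 \<Lambda>2))"
proof -
  let ?r = "CARD('r)"
  define l1 l2 where "l1 = lam ?r" and "l2 = lam (?r + 1)"
  define \<epsilon> \<delta> where "\<epsilon> = spectral_norm E" and "\<delta> = sep spectral_norm \<Lambda>1 \<Lambda>2"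

  \<comment> \<open>Eigenvalue ordering and block structure of \<open>A\<close>\<close>
  have e1_mem: "1 \<le> e1 i" "e1 i \<le> ?r" for i using bij_betwE[OF e1] by auto
  have e2_mem: "?r + 1 \<le> e2 j" "e2 j \<le> CARD('n)" for j using bij_betwE[OF e2] by auto
  have r_less: "?r < CARD('n)" using dims by simp
  have l1: "l1 \<le> lam (e1 i)" for i
    unfolding l1_def using e1_mem[of i] r_less by (intro ordered) auto
  have l2: "lam (e2 j) \<le> l2" for j
    unfolding l2_def using e2_mem[of j] by (intro ordered) auto
  have l12: "l2 < l1" using eigengap by (simp add: l1_def l2_def)

  have V12: "transpose V1 ** V2 = 0"
    by (rule distinct_eigenvectors_orthogonal[OF A_sym V1_eigenvectors V2_eigenvectors])
      (use l1 l2 l12 in \<open>smt (verit)\<close>)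
  have V21: "transpose V2 ** V1 = 0"
    by (rule distinct_eigenvectors_orthogonal[OF A_sym V2_eigenvectors V1_eigenvectors])
      (use l1 l2 l12 in \<open>smt (verit)\<close>)
  have complete: "V1 ** transpose V1 + V2 ** transpose V2 = mat 1"
    by (rule complementary_orthonormal_columns[OF dims V1_orthonormal V2_orthonormal V12])
  have V1_A: "transpose V1 ** A = \<Lambda>1 ** transpose V1"
    unfolding A_decomp
    by (simp add: matrix_add_ldistrib matrix_mul_assoc V1_orthonormal V12)
  have V2_A: "transpose V2 ** A = \<Lambda>2 ** transpose V2"
    unfolding A_decomp
    by (simp add: matrix_add_ldistrib matrix_mul_assoc V2_orthonormal V21)

  have \<epsilon>: "0 \<le> \<epsilon>" "\<epsilon> \<le> gap / 5" using E_small by (simp_all add: \<epsilon>_def spectral_norm_nonneg)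
  have gap_\<delta>: "gap \<le> \<delta>"
    and gap_sep_on: "gap \<le> sep_on two_inf_norm V2 \<Lambda>1 (V2 ** \<Lambda>2 ** transpose V2)"
    by (simp_all add: gap \<delta>_def)
  have \<delta>_le: "\<delta> \<le> l1 - l2"
  proof -
    \<comment> \<open>The preimages of \<open>r\<close> and \<open>r + 1\<close> pick the two
      diagonal entries that face each other across the eigenvalue gap.\<close>
    have "?r \<in> range e1" and "?r + 1 \<in> range e2"
      using bij_betw_imp_surj_on[OF e1] bij_betw_imp_surj_on[OF e2] r_less
      by (simp_all add: Suc_le_eq)
    then obtain i j where "e1 i = ?r" "e2 j = ?r + 1" by auto
    then show ?thesis
      using sep_diag_matrix_le[of "\<lambda>i. lam (e1 i)" "\<lambda>j. lam (e2 j)" i j] l12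
      by (simp add: \<delta>_def \<Lambda>1 \<Lambda>2 l1_def l2_def)
  qed

  \<comment> \<open>The range of \<open>V1\<close> is the trial subspace for the Weyl-type bound on
    the dominant subspace of \<open>Ahat\<close>.\<close>
  have lower: "(l1 - \<epsilon>) * (x \<bullet> x) \<le> (V1 *v x) \<bullet> (Ahat *v (V1 *v x))" for x
  proof -
    have "(V1 *v x) \<bullet> (A *v (V1 *v x)) = x \<bullet> ((transpose V1 ** A ** V1) *v x)"
      by (simp add: inner_transpose_right flip: matrix_vector_mul_assoc)
    also have "transpose V1 ** A ** V1 = \<Lambda>1"
      by (simp add: V1_A V1_orthonormal flip: matrix_mul_assoc)
    also have "l1 * (x \<bullet> x) \<le> x \<bullet> (\<Lambda>1 *v x)"
      unfolding \<Lambda>1 by (rule inner_diag_matrix_lower) (rule l1)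
    finally have 1: "l1 * (x \<bullet> x) \<le> (V1 *v x) \<bullet> (A *v (V1 *v x))" .
    have "\<bar>(V1 *v x) \<bullet> (E *v (V1 *v x))\<bar> \<le> norm (V1 *v x) * norm (E *v (V1 *v x))"
      by (rule Cauchy_Schwarz_ineq2)
    also have "\<dots> \<le> norm (V1 *v x) * (\<epsilon> * norm (V1 *v x))"
      unfolding \<epsilon>_def by (intro mult_left_mono norm_matrix_vector_le) simp
    also have "\<dots> = \<epsilon> * (x \<bullet> x)"
      by (simp add: norm_orthonormal_columns[OF V1_orthonormal] dot_square_norm power2_eq_square)
    finally have "- (\<epsilon> * (x \<bullet> x)) \<le> (V1 *v x) \<bullet> (E *v (V1 *v x))" by linarith
    with 1 show ?thesis
      by (simp add: Ahat matrix_vector_mult_add_rdistrib inner_add_right left_diff_distrib)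
  qed
  have invariant: "(A + E) *v (V1hat *v x)
      = V1hat *v (transpose V1hat *v ((A + E) *v (V1hat *v x)))" for x
    using dominant_invariant_subspace_invariant[OF V1hat_range V1hat_orthonormal] r_less
    by (simp add: Ahat)
  have "spectral_norm (transpose V2 ** V1hat) * ((l1 - \<epsilon>) - l2) \<le> spectral_norm E"
  proof (rule sin_theta_bound[OF V2_orthonormal V1hat_orthonormal V2_A])
    show "u \<bullet> (\<Lambda>2 *v u) \<le> l2 * (u \<bullet> u)" for u
      unfolding \<Lambda>2 by (rule inner_diag_matrix_upper) (rule l2)
    show "(l1 - \<epsilon>) * (x \<bullet> x) \<le> (V1hat *v x) \<bullet> ((A + E) *v (V1hat *v x))" for x
      using dominant_invariant_subspace_lower_bound[OF V1hat_range V1hat_orthonormal _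
          V1_orthonormal lower] r_less
      by (simp add: Ahat)
  qed (rule invariant)
  moreover define s where "s = spectral_norm (transpose V2 ** V1hat)"
  ultimately have s_le: "s * (l1 - l2 - \<epsilon>) \<le> \<epsilon>" by (simp add: \<epsilon>_def algebra_simps)
  have s0: "0 \<le> s" by (simp add: s_def spectral_norm_nonneg)
  have "gap \<le> l1 - l2" using gap_\<delta> \<delta>_le by (rule order_trans)
  with \<epsilon>(2) have \<epsilon>_le: "\<epsilon> \<le> (l1 - l2) / 5" by simp
  \<comment> \<open>Since \<open>\<epsilon>\<close> is at most a fifth of \<open>l1 - l2\<close>,
    the denominator \<open>l1 - l2 - \<epsilon>\<close> keeps four fifths of it, and the quotient of
    1/5 and 4/5 is 1/4.\<close>
  have s_small: "s \<le> 1/4"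
  proof -
    have "s * (4/5 * (l1 - l2)) \<le> s * (l1 - l2 - \<epsilon>)"
      using s0 \<epsilon>_le by (intro mult_left_mono) auto
    also have "\<dots> \<le> 1/4 * (4/5 * (l1 - l2))" using s_le \<epsilon>_le by simp
    finally show ?thesis using l12 by simp
  qed

  \<comment> \<open>Rotated basis and Riccati equation\<close>
  obtain U P Pinv :: "real^'r^'r" and X :: "real^'r^'s" where
    U: "orthogonal_matrix U" and W: "V1hat ** U = (V1 + V2 ** X) ** P" "P ** Pinv = mat 1"
    and P: "spectral_norm P \<le> 1" "spectral_norm (P - mat 1) \<le> (spectral_norm X)\<^sup>2"
    and X: "spectral_norm X \<le> 4/3 * s"
    by (rule graph_representation[OF V1_orthonormal V1hat_orthonormal complete
          s_small[unfolded s_def], folded s_def])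
      (rule that)
  \<comment> \<open>The matrix of \<open>A + E\<close> on the invariant subspace in the rotated
    basis \<open>V1hat ** U\<close>.\<close>
  define M where "M = transpose U ** transpose V1hat ** (A + E) ** V1hat ** U"
  have inv: "(A + E) ** V1hat = V1hat ** transpose V1hat ** (A + E) ** V1hat"
    using invariant by (simp add: matrix_eq flip: matrix_vector_mul_assoc)
  have "U ** transpose U = mat 1" using U by (simp add: orthogonal_matrix_def)
  moreover have UM: "V1hat ** U ** M
      = V1hat ** (U ** transpose U) ** transpose V1hat ** (A + E) ** V1hat ** U"
    by (simp only: M_def matrix_mul_assoc)
  ultimately have "V1hat ** U ** M = V1hat ** transpose V1hat ** (A + E) ** V1hat ** U"
    by (simp add: UM)
  then have "(A + E) ** (V1hat ** U) = V1hat ** U ** M"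
    by (simp only: matrix_mul_assoc flip: inv)
  from graph_riccati[OF V1_orthonormal V2_orthonormal V12 V21 V1_A V2_A W this]
  have riccati: "X ** \<Lambda>1 - \<Lambda>2 ** X
    = block V2 V1 E + block V2 V2 E ** X - X ** block V1 V1 E - X ** (block V1 V2 E ** X)" .

  \<comment> \<open>The error splits into a part within the range of \<open>V1\<close>, of second
    order in \<open>X\<close>, and the displacement along \<open>V2\<close>.\<close>
  have "V1hat ** U - V1 = V1 ** (P - mat 1) + (V2 ** X) ** P"
    by (simp add: W matrix_add_rdistrib matrix_diff_ldistrib)
  then have "two_inf_norm (V1hat ** U - V1)
      \<le> two_inf_norm V1 * (spectral_norm X)\<^sup>2 + two_inf_norm (V2 ** X) * 1"
    by (simp only:) (intro order_trans[OF two_inf_norm_triangle] add_mono two_inf_norm_mult_le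
        order_refl P)
  also have "\<dots> \<le> 8 * two_inf_norm V1 * (spectral_norm (block V2 V1 E) / \<delta>)\<^sup>2
      + 2 * (two_inf_norm (V2 ** block V2 V1 E) / gap)
      + 4 * ((two_inf_norm (V2 ** block V2 V2 E ** transpose V2)
          * spectral_norm (block V2 V1 E)) / (gap * \<delta>))" (is "_ \<le> ?bound")
  proof (cases "gap = 0")
    case True \<comment> \<open>The quotients by \<open>gap\<close> are then \<open>0\<close>, but \<open>E = 0\<close> makes the left-hand side vanish.\<close>
    then have "\<epsilon> = 0" using \<epsilon> by simp
    then have "s \<le> 0" using s_le l12 by (simp add: mult_le_0_iff)
    then have "X = 0"
      using X spectral_norm_nonneg[of X] by (simp add: spectral_norm_eq_0[symmetric])
    moreover have "two_inf_norm (V2 ** (0 :: real^'r^'s)) = 0"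
      using two_inf_norm_scaleR[of 0 V1] by simp
    ultimately have "two_inf_norm V1 * (spectral_norm X)\<^sup>2 + two_inf_norm (V2 ** X) * 1 = 0"
      by (simp add: spectral_norm_eq_0)
    then show ?thesis using True by (simp add: two_inf_norm_nonneg)
  next
    case False
    then have g: "0 < gap" using \<epsilon> by simp
    have "spectral_norm X \<le> 1/3" using X s_small by simp
    note bounds = riccati_bounds[OF V1_orthonormal V2_orthonormal riccati this g
        gap_\<delta>[unfolded \<delta>_def] gap_sep_on E_small, folded \<delta>_def]
    have "(spectral_norm X)\<^sup>2 \<le> (2 * (spectral_norm (block V2 V1 E) / \<delta>))\<^sup>2"
      by (rule power_mono[OF bounds(1) spectral_norm_nonneg])
    \<comment> \<open>Squaring the factor 2 in the bound on \<open>X\<close> gives 4, so the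
      constant 8 leaves room.\<close>
    also have "\<dots> \<le> 8 * (spectral_norm (block V2 V1 E) / \<delta>)\<^sup>2"
      unfolding power_mult_distrib by (intro mult_right_mono) simp_all
    finally have "two_inf_norm V1 * (spectral_norm X)\<^sup>2
        \<le> two_inf_norm V1 * (8 * (spectral_norm (block V2 V1 E) / \<delta>)\<^sup>2)"
      by (intro mult_left_mono two_inf_norm_nonneg)
    also have "\<dots> = 8 * two_inf_norm V1 * (spectral_norm (block V2 V1 E) / \<delta>)\<^sup>2"
      by (simp only: mult_ac)
    finally show ?thesis
      using bounds(2) by (simp only: mult_1_right add.assoc add_mono)
  qed
  finally have U_bound: "two_inf_norm (V1hat ** U - V1) \<le> ?bound" .

  \<comment> \<open>Passage to the minimising rotation\<close>
  obtain U0 where U0: "is_arg_min (\<lambda>U. two_inf_norm (V1hat ** U - V1)) orthogonal_matrix U0"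
    using argmin_two_inf_norm_orthogonal_exists by blast
  then have "two_inf_norm (V1hat ** U0 - V1) \<le> two_inf_norm (V1hat ** U - V1)"
    using U by (auto simp: is_arg_min_def not_less)
  with U_bound have "two_inf_norm (V1hat ** U0 - V1) \<le> ?bound" by linarith
  with U0 show ?thesis unfolding \<delta>_def by blast
qed

end
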